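(* Let $H$ be a hypergraph, $f:V(H)\to(0,\infty)$ a function, and $M_H$ an $f$-symmetric, star-dependent matrix indexed by $V(H)$. For any unit $W\in\mathfrak{U}(H)$ with $|W|\ge 2$, the vector space $C_W^f$ is an invariant subspace of $M_H$, i.e. $M_Hx\in C_W^f$ for all $x\in C_W^f$.
   Context: A hypergraph $H=(V(H),E(H))$ consists of a finite nonempty vertex set $V(H)$ and a finite family $E(H)$ of nonempty subsets of $V(H)$, called hyperedges. The star of a vertex $i$ is $E_i(H)=\{e\in E(H): i\in e\}$, and $\mathfrak{E}(H)=\{E_i(H): i\in V(H)\}$ is the set of all stars. A real matrix $M_H=(m_{ij})_{i,j\in V(H)}$ is star-dependent if there exist functions $g:\mathfrak{E}(H)\times\mathfrak{E}(H)\to\mathbb{R}$ and $h:\mathfrak{E}(H)\to\mathbb{R}$ such that $m_{ij}=g(E_i(H),E_j(H))$ if $i\neq j$ and $m_{ii}=h(E_i(H))$. The units of $H$ are the equivalence classes of the relation $\mathfrak{R}_s(H)=\{(i,j): E_i(H)=E_j(H)\}$ on $V(H)$; $\mathfrak{U}(H)$ is the set of all units. For $f:V(H)\to(0,\infty)$, let $(x,y)_f=\sum_{i\in V(H)}f(i)x(i)y(i)$ on $\mathbb{R}^{V(H)}$. The matrix $M_H$ is $f$-symmetric if $(M_Hx,y)_f=(x,M_Hy)_f$ for all $x,y\in\mathbb{R}^{V(H)}$. For $U\subseteq V(H)$, $C^f_U=\{x\in\mathbb{R}^{V(H)}: \text{there is } c_x\in\mathbb{R} \text{ with } f(i)x(i)=c_x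 \text{ for all } i\in U\}$. *)

theory Defs
  imports "HOL-Analysis.Analysis"
begin

(* The finite nonempty vertex set V(H) is the type 'v::finite, so that vectors in R^V(H) and
   matrices indexed by V(H) have types real^'v and real^'v^'v.  A hypergraph is given by its
   set of hyperedges. Repeating a hyperedge does not affect which vertices have equal stars. *)

definition hypergraph :: "'v::finite set set \<Rightarrow> bool" where
  "hypergraph H \<longleftrightarrow> finite H \<and> {} \<notin> H"

definition star :: "'v::finite set set \<Rightarrow> 'v \<Rightarrow> 'v set set" where
  "star H i = {e \<in> H. i \<in> e}"

(* g and h are total functions; only their values on the stars of H matter. *)
definition star_dependent :: "'v::finite set set \<Rightarrow> real^'v^'v \<Rightarrow> bool" where
  "star_dependent H M \<longleftrightarrow>
     (\<exists>(g :: 'v set set \<Rightarrow> 'v set set \<Rightarrow> real) (h :: 'v set set \<Rightarrow> real).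
        (\<forall>i j. i \<noteq> j \<longrightarrow> M $ i $ j = g (star H i) (star H j)) \<and>
        (\<forall>i. M $ i $ i = h (star H i)))"

definition star_rel :: "'v::finite set set \<Rightarrow> ('v \<times> 'v) set" where
  "star_rel H = {(i, j). star H i = star H j}"

definition units_of_hypergraph :: "'v::finite set set \<Rightarrow> 'v set set" where
  "units_of_hypergraph H = UNIV // star_rel H"

definition weighted_inner :: "('v::finite \<Rightarrow> real) \<Rightarrow> real^'v \<Rightarrow> real^'v \<Rightarrow> real" where
  "weighted_inner f x y = (\<Sum>i\<in>UNIV. f i * x $ i * y $ i)"

definition f_symmetric :: "('v::finite \<Rightarrow> real) \<Rightarrow> real^'v^'v \<Rightarrow> bool" where
  "f_symmetric f M \<longleftrightarrow> (\<forall>x y. weighted_inner f (M *v x) y = weighted_inner f x (M *v y))"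

definition C_space :: "('v::finite \<Rightarrow> real) \<Rightarrow> 'v set \<Rightarrow> (real^'v) set" where
  "C_space f U = {x. \<exists>c::real. \<forall>i\<in>U. f i * x $ i = c}"

definition invariant_subspace :: "real^'v^'v \<Rightarrow> (real^'v::finite) set \<Rightarrow> bool" where
  "invariant_subspace M S \<longleftrightarrow> subspace S \<and> (\<forall>x\<in>S. M *v x \<in> S)"

end

theory Submission
  imports Defs "HOL-Combinatorics.Transposition"
begin

text \<open>
  Symmetry with respect to the weighted inner product means that \<open>f i * M $ i $ j = f j * M $ j $ i\<close>.
  Hence passing from \<open>x\<close> to \<open>y = (\<lambda>i. f i * x $ i)\<close> turns the action of \<open>M\<close> into that of its
  transpose (\<open>f_symmetric_weighted_action\<close>), and turns the condition defining
  \<open>C_space f W\<close> into the condition that \<open>y\<close> be constant on \<open>W\<close>, with no weights left.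
  It remains to see that the transpose preserves constancy on a unit. A star-dependent matrix is
  unchanged when two vertices with equal stars are swapped in both indices
  (\<open>star_dependent_swap_invariant\<close>). If \<open>y\<close> takes equal values at the two vertices, it is
  unchanged by the swap as well, and reindexing the sums along the swap shows that the image of
  \<open>y\<close> takes equal values there too.
\<close>

lemma f_symmetric_entries:
  assumes "f_symmetric f M"
  shows "f i * M $ i $ j = f j * M $ j $ i"
proof -
  have "weighted_inner f (M *v axis j 1) (axis i 1) = weighted_inner f (axis j 1) (M *v axis i 1)"
    using assms unfolding f_symmetric_def by blast
  then show ?thesis
    unfolding matrix_vector_mult_basis
    by (simp add: weighted_inner_def column_def axis_def if_distrib if_distribR cong: if_cong)
qed

lemma f_symmetric_weighted_action:
  assumes "f_symmetric f M"
  shows "f i * (M *v x) $ i = (\<Sum>j\<in>UNIV. M $ j $ i * (f j * x $ j))"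
proof -
  have "f i * (M *v x) $ i = (\<Sum>j\<in>UNIV. (f i * M $ i $ j) * x $ j)"
    by (simp add: matrix_vector_mult_def sum_distrib_left mult.assoc)
  also have "\<dots> = (\<Sum>j\<in>UNIV. M $ j $ i * (f j * x $ j))"
    unfolding f_symmetric_entries[OF assms, of i] by (simp add: mult_ac)
  finally show ?thesis .
qed

text \<open>
  Swapping \<open>p\<close> and \<open>q\<close> changes no star, and it sends diagonal entries to diagonal entries
  and off-diagonal ones to off-diagonal ones, so the same function \<open>g\<close> or \<open>h\<close>
  describes an entry before and after the swap, with the same arguments.
\<close>

lemma star_dependent_swap_invariant:
  assumes "star_dependent H M" and pq: "star H p = star H q"
  shows "M $ Transposition.transpose p q i $ Transposition.transpose p q j = M $ i $ j"
proof -
  obtain g h where g: "\<And>i j. i \<noteq> j \<Longrightarrow> M $ i $ j = g (star H i) (star H j)"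
    and h: "\<And>i. M $ i $ i = h (star H i)"
    using assms(1) unfolding star_dependent_def by blast
  have star: "star H (Transposition.transpose p q k) = star H k" for k
    using pq by (simp add: Transposition.transpose_def)
  show ?thesis
    by (cases "i = j") (simp_all add: g h star inj_eq[OF bij_is_inj[OF bij_transpose]])
qed

lemma star_dependent_equal_column_sums:
  assumes "star_dependent H M" and "star H p = star H q" and y: "y p = y q"
  shows "(\<Sum>j\<in>UNIV. M $ j $ p * y j) = (\<Sum>j\<in>UNIV. M $ j $ q * y j)"
proof -
  have "(\<Sum>j\<in>UNIV. M $ j $ q * y j)
      = (\<Sum>j\<in>UNIV. M $ Transposition.transpose p q j $ q * y (Transposition.transpose p q j))"
    by (rule sum.reindex_bij_betw[OF bij_transpose, symmetric])
  also have "\<dots> = (\<Sum>j\<in>UNIV. M $ j $ p * y j)"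
  proof (rule sum.cong[OF refl])
    fix j
    have "M $ Transposition.transpose p q j $ q = M $ j $ p"
      using star_dependent_swap_invariant[OF assms(1,2), of j p] by simp
    moreover have "y (Transposition.transpose p q j) = y j"
      using y by (simp add: Transposition.transpose_def)
    ultimately show "M $ Transposition.transpose p q j $ q * y (Transposition.transpose p q j) = M $ j $ p * y j"
      by simp
  qed
  finally show ?thesis by simp
qed

lemma unit_same_star:
  assumes "W \<in> units_of_hypergraph H" "p \<in> W" "q \<in> W"
  shows "star H p = star H q"
  using assms by (auto simp: units_of_hypergraph_def star_rel_def quotient_def)

lemma C_space_iff:
  "x \<in> C_space f U \<longleftrightarrow> (\<forall>p\<in>U. \<forall>q\<in>U. f p * x $ p = f q * x $ q)"
proof
  assume "x \<in> C_space f U"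
  then obtain c where "\<forall>i\<in>U. f i * x $ i = c"
    unfolding C_space_def by blast
  then show "\<forall>p\<in>U. \<forall>q\<in>U. f p * x $ p = f q * x $ q"
    by simp
next
  assume const: "\<forall>p\<in>U. \<forall>q\<in>U. f p * x $ p = f q * x $ q"
  show "x \<in> C_space f U"
  proof (cases "U = {}")
    case True
    then show ?thesis by (simp add: C_space_def)
  next
    case False
    then obtain q where "q \<in> U" by blast
    with const have "\<forall>i\<in>U. f i * x $ i = f q * x $ q" by blast
    then show ?thesis unfolding C_space_def by blast
  qed
qed

lemma subspace_C_space: "subspace (C_space f U)"
proof (rule subspaceI)
  show "0 \<in> C_space f U"
    by (simp add: C_space_iff)
next
  fix x y assume "x \<in> C_space f U" "y \<in> C_space f U"
  then obtain c d where "\<forall>i\<in>U. f i * x $ i = c" "\<forall>i\<in>U. f i * y $ i = d"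
    unfolding C_space_def by blast
  then have "\<forall>i\<in>U. f i * (x + y) $ i = c + d"
    by (simp add: distrib_left)
  then show "x + y \<in> C_space f U"
    unfolding C_space_def by blast
next
  fix a x assume "x \<in> C_space f U"
  then obtain c where "\<forall>i\<in>U. f i * x $ i = c"
    unfolding C_space_def by blast
  then have "\<forall>i\<in>U. f i * (a *\<^sub>R x) $ i = a * c"
    by (simp add: mult.left_commute[of _ a])
  then show "a *\<^sub>R x \<in> C_space f U"
    unfolding C_space_def by blast
qed

theorem corollary2p15:
  fixes H :: "'v::finite set set"
    and f :: "'v \<Rightarrow> real"
    and M :: "real^'v^'v"
    and W :: "'v set"
  assumes "hypergraph H"
    and "\<And>i. f i > 0"
    and "f_symmetric f M"
    and "star_dependent H M"
    and "W \<in> units_of_hypergraph H"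
    and "card W \<ge> 2"
  shows "invariant_subspace M (C_space f W)"
  unfolding invariant_subspace_def
proof (intro conjI ballI subspace_C_space)
  fix x assume x: "x \<in> C_space f W"
  have "f p * (M *v x) $ p = f q * (M *v x) $ q" if "p \<in> W" "q \<in> W" for p q
    unfolding f_symmetric_weighted_action[OF assms(3)]
  proof (rule star_dependent_equal_column_sums[OF assms(4)])
    show "star H p = star H q"
      using unit_same_star[OF assms(5) that] .
    show "f p * x $ p = f q * x $ q"
      using x that unfolding C_space_iff by blast
  qed
  then show "M *v x \<in> C_space f W"
    unfolding C_space_iff by blast
qed

end
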